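(* For any positive integers $a,k$, $$\omega(k,a)\leq \left\lceil \frac{k}{2}\right\rceil a^{\left\lceil \frac{k}{2}\right\rceil} + \left\lfloor \frac{k}{2}\right\rfloor a^{\left\lfloor \frac{k}{2}\right\rfloor}.$$
   Context: Let $\mathcal A=\{1,2,\ldots,a\}$. A submatrix of a matrix is obtained by selecting some rows and some columns (not necessarily contiguous), keeping their order. An omnimosaic $O(n,k,a)$ is an $n\times n$ matrix with entries in $\mathcal A$ that contains, as a submatrix, each of the $a^{k^2}$ $k\times k$ matrices over $\mathcal A$. For positive integers $k,a$, $\omega(k,a)$ denotes the smallest $n$ for which an $O(n,k,a)$ omnimosaic exists. *)

theory Defs
  imports Complex_Main "Jordan_Normal_Form.DL_Submatrix"
begin

definition matrices_over :: "'a set \<Rightarrow> nat \<Rightarrow> nat \<Rightarrow> 'a mat set" where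
  "matrices_over A m n = {M \<in> carrier_mat m n. elements_mat M \<subseteq> A}"

definition contains_submatrix :: "'a mat \<Rightarrow> 'a mat \<Rightarrow> bool" where
  "contains_submatrix M B \<longleftrightarrow>
     (\<exists>I J. I \<subseteq> {..<dim_row M} \<and> J \<subseteq> {..<dim_col M} \<and> submatrix M I J = B)"

definition omnimosaic :: "nat \<Rightarrow> nat \<Rightarrow> nat \<Rightarrow> nat mat \<Rightarrow> bool" where
  "omnimosaic n k a M \<longleftrightarrow>
     M \<in> matrices_over {1..a} n n \<and>
     (\<forall>B \<in> matrices_over {1..a} k k. contains_submatrix M B)"

definition omega :: "nat \<Rightarrow> nat \<Rightarrow> nat" where
  "omega k a = (LEAST n. \<exists>M. omnimosaic n k a M)"

text \<open>
  The minimum in \<open>omega\<close> is attained for positive \<open>k\<close> and \<open>a\<close>, so that \<open>LEAST\<close> is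
  never taken over an empty predicate: stack all \<open>k \<times> k\<close> matrices vertically and
  repeat the stack horizontally.
\<close>

lemma pick_interval:
  assumes "i < k"
  shows "pick {s..<s + k} i = s + i"
proof -
  have "{x \<in> {s..<s + k}. x < s + i} = {s..<s + i}"
    using assms by auto
  then show ?thesis
    using pick_card_in_set[of "s + i" "{s..<s + k}"] assms by simp
qed

lemma finite_matrices_over:
  assumes "finite A"
  shows "finite (matrices_over A m n)"
proof (rule finite_subset)
  let ?D = "{..<m} \<times> {..<n}"
  show "matrices_over A m n \<subseteq> mat m n ` (?D \<rightarrow>\<^sub>E A)"
  proof
    fix M assume M: "M \<in> matrices_over A m n"
    have "M = mat m n (restrict (\<lambda>ij. M $$ ij) ?D)"
      using M by (intro eq_matI) (auto simp: matrices_over_def)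
    moreover have "restrict (\<lambda>ij. M $$ ij) ?D \<in> ?D \<rightarrow>\<^sub>E A"
      using M by (auto simp: matrices_over_def intro!: subsetD[of "elements_mat M" A])
    ultimately show "M \<in> mat m n ` (?D \<rightarrow>\<^sub>E A)" by blast
  qed
  show "finite (mat m n ` (?D \<rightarrow>\<^sub>E A))"
    using assms by (intro finite_imageI finite_PiE) auto
qed

lemma omnimosaic_exists:
  assumes "k > 0" "a > 0"
  shows "\<exists>n M. omnimosaic n k a M"
proof -
  obtain Bs where Bs: "set Bs = matrices_over {1..a} k k"
    using finite_list[OF finite_matrices_over[of "{1..a}" k k]] by auto
  define n where "n = length Bs * k"
  define M where "M = mat n n (\<lambda>(i, j). (Bs ! (i div k)) $$ (i mod k, j mod k))"
  have entry: "(Bs ! (i div k)) $$ (i mod k, j mod k) \<in> {1..a}" if "i < n" for i j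
  proof -
    have "i div k < length Bs"
      using that assms(1) by (simp add: n_def less_mult_imp_div_less)
    then have "Bs ! (i div k) \<in> matrices_over {1..a} k k"
      using Bs nth_mem by blast
    then show ?thesis
      using assms(1) elements_matI[of "Bs ! (i div k)" k k "i mod k" "j mod k"]
      unfolding matrices_over_def by (metis (mono_tags, lifting) mem_Collect_eq mod_less_divisor subsetD)
  qed
  have "M \<in> matrices_over {1..a} n n"
    unfolding matrices_over_def M_def using entry by (force dest!: elements_matD)
  moreover have "contains_submatrix M B" if B: "B \<in> matrices_over {1..a} k k" for B
  proof -
    obtain t where t: "t < length Bs" "Bs ! t = B"
      using B Bs by (metis in_set_conv_nth)
    have dims: "dim_row M = n" "dim_col M = n" by (auto simp: M_def)
    have dimB: "dim_row B = k" "dim_col B = k" using B by (auto simp: matrices_over_def)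
    have "Suc t * k \<le> length Bs * k" using t(1) by (intro mult_right_mono) auto
    then have tn: "t * k + k \<le> n" by (simp add: n_def add.commute)
    then have kn: "k \<le> n" by simp
    let ?I = "{t * k..<t * k + k}" and ?J = "{0..<0 + k}"
    have I: "{i. i < n \<and> i \<in> ?I} = ?I" and J: "{j. j < n \<and> j \<in> ?J} = ?J"
      using tn kn by auto
    have "submatrix M ?I ?J = B"
    proof (rule eq_matI)
      fix i j assume "i < dim_row B" "j < dim_col B"
      then have ij: "i < k" "j < k" by (simp_all add: dimB)
      then have "submatrix M ?I ?J $$ (i, j) = M $$ (t * k + i, 0 + j)"
        using submatrix_index[of i M ?I j ?J] pick_interval[of i k "t * k"] pick_interval[of j k 0]
        unfolding dims I J by simp
      also have "\<dots> = B $$ (i, j)"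
        using ij tn kn t(2) by (simp add: M_def)
      finally show "submatrix M ?I ?J $$ (i, j) = B $$ (i, j)" .
    qed (simp_all only: dim_submatrix dims I J dimB, simp_all)
    moreover have "?I \<subseteq> {..<dim_row M}" "?J \<subseteq> {..<dim_col M}"
      using tn kn by (auto simp: dims)
    ultimately show ?thesis unfolding contains_submatrix_def by blast
  qed
  ultimately show ?thesis unfolding omnimosaic_def by blast
qed

end

theory Submission
  imports Defs
begin

text \<open>
  A \<open>k \<times> k\<close> matrix \<open>B\<close> has \<open>k\<^sup>2\<close> entries, and choosing it inside a large matrix means choosing
  \<open>k\<close> rows and \<open>k\<close> columns.  The idea is to split the responsibility for the entries evenly
  between the two choices.  Declare that the entry \<open>(i, j)\<close> of \<open>B\<close> is dictated by the
  \<open>i\<close>-th chosen row if \<open>i + j\<close> is even, and by the \<open>j\<close>-th chosen column if \<open>i + j\<close> is odd.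
  Then each chosen row or column only has to carry about \<open>k / 2\<close> symbols.

  The rows of the large matrix come in \<open>k\<close> consecutive blocks.  Block \<open>i\<close> has one row for each
  assignment of symbols to the positions \<open>j\<close> for which \<open>(i, j)\<close> is dictated by the row; the
  columns are organised in the same way.  The entry where row \<open>f\<close> of block \<open>i\<close> meets column
  \<open>g\<close> of block \<open>j\<close> is \<open>f j\<close> or \<open>g i\<close>, according to which of the two dictates it.  To find \<open>B\<close>,
  pick from each block the line that carries the right symbols; since the blocks are
  consecutive, the picked lines appear in the right order.  This works for every way of
  distributing the entries (\<open>omnimosaic_of_distribution\<close>).

  Let \<open>m\<close> and \<open>l\<close> be \<open>k / 2\<close> rounded up and down.  Counting from 0, there are
  \<open>m\<close> even and \<open>l\<close> odd indices.  In the checkerboard distribution an even-numbered row dictates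
  \<open>m\<close> entries and an odd-numbered one \<open>l\<close>, so the number of rows is \<open>m a\<^sup>m + l a\<^sup>l\<close>.
  For columns it is the other way round, which gives \<open>m a\<^sup>l + l a\<^sup>m\<close> columns.
  By the rearrangement inequality this is no larger, and the missing columns are filled in
  arbitrarily.
\<close>

lemma pick_image_strict_mono_on:
  assumes p: "strict_mono_on {..<k} p" and i: "i < k"
  shows "pick (p ` {..<k}) i = p i"
proof -
  have "{x \<in> p ` {..<k}. x < p i} = p ` {..<i}"
    using i strict_mono_on_less[OF p] by fastforce
  moreover have "card (p ` {..<i}) = i"
    using strict_mono_on_imp_inj_on[OF p] i
    by (subst card_image) (auto intro: inj_on_subset)
  ultimately show ?thesis
    using pick_card_in_set[of "p i" "p ` {..<k}"] i by simp
qed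

lemma submatrix_image_strict_mono_on:
  assumes p: "strict_mono_on {..<k} p" "p ` {..<k} \<subseteq> {..<dim_row M}"
    and q: "strict_mono_on {..<l} q" "q ` {..<l} \<subseteq> {..<dim_col M}"
  shows "submatrix M (p ` {..<k}) (q ` {..<l}) = mat k l (\<lambda>(i, j). M $$ (p i, q j))"
proof -
  have "{i. i < dim_row M \<and> i \<in> p ` {..<k}} = p ` {..<k}"
    "{j. j < dim_col M \<and> j \<in> q ` {..<l}} = q ` {..<l}"
    using p(2) q(2) by auto
  moreover have "card (p ` {..<k}) = k" "card (q ` {..<l}) = l"
    using p(1) q(1) by (simp_all add: card_image strict_mono_on_imp_inj_on)
  ultimately have c: "card {i. i < dim_row M \<and> i \<in> p ` {..<k}} = k"
    "card {j. j < dim_col M \<and> j \<in> q ` {..<l}} = l"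
    by simp_all
  show ?thesis
    by (rule eq_matI)
      (auto simp: dim_submatrix submatrix_index c pick_image_strict_mono_on[OF p(1)]
        pick_image_strict_mono_on[OF q(1)])
qed

text \<open>
  List the elements of \<open>V 0\<close>, then those of \<open>V 1\<close>, and so on, each tagged with the number of
  its block.  Every choice of one element from each block then occurs as a subsequence.
\<close>

lemma consecutive_blocks:
  fixes V :: "nat \<Rightarrow> 'b set"
  assumes "\<And>i. i < k \<Longrightarrow> finite (V i)"
  shows "\<exists>L. \<forall>v. (\<forall>i<k. v i \<in> V i) \<longrightarrow>
    (\<exists>p. strict_mono_on {..<k} p \<and> (\<forall>i<k. p i < (\<Sum>i<k. card (V i)) \<and> L (p i) = (i, v i)))"
  using assms
proof (induction k)
  case 0
  then show ?case by (auto simp: strict_mono_on_def)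
next
  case (Suc k)
  let ?S = "\<Sum>i<k. card (V i)"
  obtain L where L: "\<And>v. \<forall>i<k. v i \<in> V i \<Longrightarrow>
      \<exists>p. strict_mono_on {..<k} p \<and> (\<forall>i<k. p i < ?S \<and> L (p i) = (i, v i))"
    using Suc by (metis less_SucI)
  obtain e where e: "bij_betw e {..<card (V k)} (V k)"
    using ex_bij_betw_nat_finite[of "V k"] Suc.prems by (auto simp: atLeast0LessThan)
  let ?L = "\<lambda>x. if x < ?S then L x else (k, e (x - ?S))"
  show ?case
  proof (intro exI[of _ ?L] allI impI)
    fix v assume v: "\<forall>i<Suc k. v i \<in> V i"
    then obtain p where p: "strict_mono_on {..<k} p" "\<And>i. i < k \<Longrightarrow> p i < ?S \<and> L (p i) = (i, v i)"
      using L[of v] by auto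
    obtain x where x: "x < card (V k)" "e x = v k"
      using e v unfolding bij_betw_def by (metis imageE lessI lessThan_iff)
    let ?p = "p(k := ?S + x)"
    have "strict_mono_on {..<Suc k} ?p"
      using p strict_mono_onD[OF p(1)]
      by (auto intro!: strict_mono_onI simp: less_Suc_eq trans_less_add1)
    moreover have "?p i < (\<Sum>i<Suc k. card (V i)) \<and> ?L (?p i) = (i, v i)" if "i < Suc k" for i
      using that p(2)[of i] x by (auto simp: less_Suc_eq)
    ultimately show "\<exists>p. strict_mono_on {..<Suc k} p \<and>
        (\<forall>i<Suc k. p i < (\<Sum>i<Suc k. card (V i)) \<and> ?L (p i) = (i, v i))"
      by blast
  qed
qed

text \<open>
  Read \<open>P i j\<close> as: the entry \<open>(i, j)\<close> of the submatrix is dictated by the \<open>i\<close>-th chosen row,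
  and otherwise by the \<open>j\<close>-th chosen column.  The two sums then count the row labels and the
  column labels, that is, the pairs of a block and the symbols carried by a line of that block.
  Since each entry is dictated by exactly one of its two lines, the row choices and the column
  choices can be made independently of each other.
\<close>

lemma omnimosaic_of_distribution:
  fixes P :: "nat \<Rightarrow> nat \<Rightarrow> bool"
  assumes a: "a > 0"
    and rows: "(\<Sum>i<k. a ^ card {j. j < k \<and> P i j}) \<le> n"
    and cols: "(\<Sum>j<k. a ^ card {i. i < k \<and> \<not> P i j}) \<le> n"
  shows "\<exists>M. omnimosaic n k a M"
proof -
  define R where "R = (\<lambda>i. {j. j < k \<and> P i j} \<rightarrow>\<^sub>E {1..a})"
  define C where "C = (\<lambda>j. {i. i < k \<and> \<not> P i j} \<rightarrow>\<^sub>E {1..a})"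
  have fin: "finite (R i)" "finite (C i)" for i
    by (auto simp: R_def C_def intro!: finite_PiE)
  have card: "card (R i) = a ^ card {j. j < k \<and> P i j}"
    "card (C i) = a ^ card {j. j < k \<and> \<not> P j i}" for i
    by (simp_all add: R_def C_def card_funcsetE)
  obtain L where L: "\<And>v. \<forall>i<k. v i \<in> R i \<Longrightarrow>
      \<exists>p. strict_mono_on {..<k} p \<and> (\<forall>i<k. p i < (\<Sum>i<k. card (R i)) \<and> L (p i) = (i, v i))"
    using consecutive_blocks[of k R] fin by blast
  obtain K where K: "\<And>v. \<forall>j<k. v j \<in> C j \<Longrightarrow>
      \<exists>q. strict_mono_on {..<k} q \<and> (\<forall>j<k. q j < (\<Sum>j<k. card (C j)) \<and> K (q j) = (j, v j))"
    using consecutive_blocks[of k C] fin by blast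
  define entry where "entry = (\<lambda>(i, f) (j, g). if P i j then f j else g i :: nat)"
  \<comment> \<open>Rows and columns beyond the last block have arbitrary labels; the minimum and the maximum
    force the entries there into the alphabet and leave all other entries unchanged.\<close>
  define M where "M = mat n n (\<lambda>(x, y). max 1 (min a (entry (L x) (K y))))"
  have dim: "dim_row M = n" "dim_col M = n" by (simp_all add: M_def)
  have "M \<in> matrices_over {1..a} n n"
    unfolding matrices_over_def M_def using a by (force dest!: elements_matD)
  moreover have "contains_submatrix M B" if B: "B \<in> matrices_over {1..a} k k" for B
  proof -
    have dimB: "dim_row B = k" "dim_col B = k" and BA: "elements_mat B \<subseteq> {1..a}"
      using B by (auto simp: matrices_over_def)
    have Bij: "B $$ (i, j) \<in> {1..a}" if "i < k" "j < k" for i j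
      using that BA dimB elements_matI[of B k k i j] by (metis carrier_matI subsetD)
    define f where "f = (\<lambda>i. restrict (\<lambda>j. B $$ (i, j)) {j. j < k \<and> P i j})"
    define g where "g = (\<lambda>j. restrict (\<lambda>i. B $$ (i, j)) {i. i < k \<and> \<not> P i j})"
    have "\<forall>i<k. f i \<in> R i" "\<forall>j<k. g j \<in> C j"
      unfolding f_def g_def R_def C_def by (auto simp only: restrict_PiE_iff intro!: Bij)
    then obtain p q where
      p: "strict_mono_on {..<k} p" "\<And>i. i < k \<Longrightarrow> p i < n \<and> L (p i) = (i, f i)" and
      q: "strict_mono_on {..<k} q" "\<And>j. j < k \<Longrightarrow> q j < n \<and> K (q j) = (j, g j)"
      using L[of f] K[of g] rows cols unfolding card by (meson less_le_trans)
    have sub: "p ` {..<k} \<subseteq> {..<dim_row M}" "q ` {..<k} \<subseteq> {..<dim_col M}"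
      using p(2) q(2) by (auto simp: dim)
    have Mpq: "M $$ (p i, q j) = B $$ (i, j)" if "i < k" "j < k" for i j
      using that p(2)[of i] q(2)[of j] Bij[of i j]
      by (simp add: M_def entry_def f_def g_def)
    have "submatrix M (p ` {..<k}) (q ` {..<k}) = B"
      unfolding submatrix_image_strict_mono_on[OF p(1) sub(1) q(1) sub(2)]
      by (rule eq_matI) (auto simp: dimB Mpq)
    then show ?thesis
      using sub unfolding contains_submatrix_def by blast
  qed
  ultimately show ?thesis unfolding omnimosaic_def by blast
qed

lemma card_even_lessThan: "card {j. j < k \<and> even j} = (k + 1) div 2"
proof (induction k)
  case (Suc k)
  have "{j. j < Suc k \<and> even j} = (if even k then insert k else id) {j. j < k \<and> even j}"
    by (auto simp: less_Suc_eq)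
  with Suc show ?case by auto
qed simp

lemma card_odd_lessThan: "card {j. j < k \<and> odd j} = k div 2"
proof (induction k)
  case (Suc k)
  have "{j. j < Suc k \<and> odd j} = (if odd k then insert k else id) {j. j < k \<and> odd j}"
    by (auto simp: less_Suc_eq)
  with Suc show ?case by auto
qed simp

lemma sum_even_odd_lessThan:
  "(\<Sum>i<k. if even i then x else y) = (k + 1) div 2 * x + k div 2 * (y :: nat)"
proof -
  have "{..<k} \<inter> {i. even i} = {i. i < k \<and> even i}" "{..<k} \<inter> - {i. even i} = {i. i < k \<and> odd i}"
    by auto
  then show ?thesis
    by (simp add: sum.If_cases card_even_lessThan card_odd_lessThan)
qed

theorem theorem2p1:
  fixes a k :: nat
  assumes "a > 0" and "k > 0"
  shows "omega k a \<le>
           nat \<lceil>real k / 2\<rceil> * a ^ nat \<lceil>real k / 2\<rceil>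
         + nat \<lfloor>real k / 2\<rfloor> * a ^ nat \<lfloor>real k / 2\<rfloor>"
proof -
  define m l where "m = (k + 1) div 2" and "l = k div 2"
  let ?n = "m * a ^ m + l * a ^ l"
  have round: "nat \<lceil>real k / 2\<rceil> = m" "nat \<lfloor>real k / 2\<rfloor> = l"
    unfolding m_def l_def by linarith+
  have "a ^ card {j. j < k \<and> even (i + j)} = (if even i then a ^ m else a ^ l)" for i
    by (simp add: m_def l_def card_even_lessThan card_odd_lessThan)
  then have rows: "(\<Sum>i<k. a ^ card {j. j < k \<and> even (i + j)}) = m * a ^ m + l * a ^ l"
    by (simp add: sum_even_odd_lessThan m_def l_def)
  have "a ^ card {i. i < k \<and> odd (i + j)} = (if even j then a ^ l else a ^ m)" for j
    by (simp add: m_def l_def card_even_lessThan card_odd_lessThan)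
  then have cols: "(\<Sum>j<k. a ^ card {i. i < k \<and> odd (i + j)}) = m * a ^ l + l * a ^ m"
    by (simp add: sum_even_odd_lessThan m_def l_def)
  have "m * a ^ l + l * a ^ m \<le> ?n"
  proof -
    consider "m = l" | "m = Suc l" unfolding m_def l_def by linarith
    then show ?thesis using assms(1) by cases auto
  qed
  with rows cols have "\<exists>M. omnimosaic ?n k a M"
    by (intro omnimosaic_of_distribution[where P = "\<lambda>i j. even (i + j)"] assms) simp_all
  then show ?thesis
    unfolding omega_def round by (rule Least_le)
qed

end
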